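(* For every $\epsilon\in(0,\epsilon^{*}]$ and every $u_0\in B_{r^*}$, the implicit Euler scheme $u_n^\epsilon=u_{n-1}^\epsilon+\epsilon F u_n^\epsilon$ ($n=1,2,\dots$) with $u_0^\epsilon=u_0$ has a unique solution $u_n^\epsilon(u_0)\in B_{r^*}$, for every $n\in\mathbb N$.
   Context: $\ell^2$ is the Hilbert space of real square-summable sequences $u=(u_i)_{i\in\mathbb Z}$ with inner product $(u,v)=\sum_i u_iv_i$ and norm $\|u\|=\sqrt{(u,u)}$; $B_r=\{u\in\ell^2:\|u\|\le r\}$. Parameters: $\alpha,\beta,\nu,\lambda>0$, $\gamma\in(0,1)$, and $f=(f_i)_{i\in\mathbb Z}\in\ell^2$. Operators on $\ell^2$: $(\Lambda u)_i=-u_{i-1}+2u_i-u_{i+1}$, $(D^-u)_i=u_{i-1}-u_i$. Products of sequences are componentwise. The Burgers-Huxley vector field is $Fu=\nu\Lambda u-\alpha uD^-u+\beta u(1-u)(u-\gamma)-\lambda u+f$. Constants: $\lambda^*=4\nu+\frac{(2\alpha+\beta+\beta\gamma)^2}{4\beta}-\beta\gamma$. Standing assumption: $\lambda>\lambda^*$. For $r>0$, $M_r=\beta r^3+(2\alpha+\beta+\beta\gamma)r^2+(4\nu+\beta\gamma+\lambda)r+\|f\|$ and $L_r=4\nu+2\sqrt5\,r\alpha+\sqrt{12r^2(1+\gamma)^2+27r^4+3\gamma^2}\,\beta+\lambda$. Finally $r^*=1+\frac{\|f\|}{\lambda-\lambda^*}$ and $\epsilon^*=\min\left(\frac1{M_{r^*+1}},\frac1{1+L_{r^*+1}}\right)$.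 *)

theory Defs
  imports "HOL-Analysis.Analysis"
begin

section \<open>The Hilbert space of real square-summable sequences indexed by the integers\<close>

definition sq_summable :: "(int \<Rightarrow> real) \<Rightarrow> bool" where
  "sq_summable u \<longleftrightarrow> (\<lambda>i. (u i)\<^sup>2) summable_on UNIV"

lemma sq_summable_dominated:
  assumes "sq_summable u" "\<And>i. \<bar>v i\<bar> \<le> c * \<bar>u i\<bar>"
  shows "sq_summable v"
  unfolding sq_summable_def
proof (rule summable_on_comparison_test)
  show "(\<lambda>i. c\<^sup>2 * (u i)\<^sup>2) summable_on UNIV"
    using assms(1) by (intro summable_on_cmult_right) (simp add: sq_summable_def)
  show "(v i)\<^sup>2 \<le> c\<^sup>2 * (u i)\<^sup>2" for i
    using power_mono[OF assms(2)[of i] abs_ge_zero, of 2] by (simp add: power_mult_distrib)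
qed simp

lemma sq_summable_add:
  assumes "sq_summable u" "sq_summable v"
  shows "sq_summable (\<lambda>i. u i + v i)"
  unfolding sq_summable_def
proof (rule summable_on_comparison_test)
  show "(\<lambda>i. 2 * (u i)\<^sup>2 + 2 * (v i)\<^sup>2) summable_on UNIV"
    using assms by (intro summable_on_add summable_on_cmult_right) (simp_all add: sq_summable_def)
  show "(u i + v i)\<^sup>2 \<le> 2 * (u i)\<^sup>2 + 2 * (v i)\<^sup>2" for i
    using zero_le_power2[of "u i - v i"] by (simp add: power2_eq_square algebra_simps)
qed simp

lemma sq_summable_scale: "sq_summable u \<Longrightarrow> sq_summable (\<lambda>i. c * u i)"
  by (rule sq_summable_dominated[where c = "\<bar>c\<bar>"]) (auto simp: abs_mult)

lemma sq_summable_uminus: "sq_summable u \<Longrightarrow> sq_summable (\<lambda>i. - u i)"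
  by (rule sq_summable_dominated[where c = 1]) auto

lemma sq_summable_diff:
  "sq_summable u \<Longrightarrow> sq_summable v \<Longrightarrow> sq_summable (\<lambda>i. u i - v i)"
  using sq_summable_add[OF _ sq_summable_uminus, of u v] by simp

lemma sq_summable_shift:
  assumes "sq_summable u"
  shows "sq_summable (\<lambda>i. u (i + k))"
proof -
  have "bij_betw (\<lambda>i::int. i + k) UNIV UNIV"
    by (rule bij_betwI[where g = "\<lambda>i. i - k"]) auto
  from summable_on_reindex_bij_betw[OF this, of "\<lambda>i. (u i)\<^sup>2"] assms
  show ?thesis by (simp add: sq_summable_def)
qed

lemma sq_summable_bounded:
  assumes "sq_summable u"
  shows "\<exists>c. \<forall>i. \<bar>u i\<bar> \<le> c"
proof (intro exI allI)
  fix i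
  have "sum (\<lambda>i. (u i)\<^sup>2) {i} \<le> (\<Sum>\<^sub>\<infinity>i. (u i)\<^sup>2)"
    using assms by (intro finite_sum_le_infsum) (auto simp: sq_summable_def)
  then show "\<bar>u i\<bar> \<le> sqrt (\<Sum>\<^sub>\<infinity>i. (u i)\<^sup>2)"
    by (intro real_le_rsqrt) simp
qed

lemma sq_summable_mult:
  assumes "sq_summable u" "sq_summable v"
  shows "sq_summable (\<lambda>i. u i * v i)"
proof -
  obtain c where "\<And>i. \<bar>u i\<bar> \<le> c"
    using sq_summable_bounded[OF assms(1)] by blast
  then show ?thesis
    by (intro sq_summable_dominated[OF assms(2), where c = c])
      (simp add: abs_mult mult_right_mono)
qed

lemma sq_summable_inner:
  assumes "sq_summable u" "sq_summable v"
  shows "(\<lambda>i. u i * v i) summable_on UNIV"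
proof -
  have "(\<lambda>i. (1/4) * (u i + v i)\<^sup>2 + (-1/4) * (u i - v i)\<^sup>2) summable_on UNIV"
    using sq_summable_add[OF assms] sq_summable_diff[OF assms]
    by (intro summable_on_add summable_on_cmult_right) (simp_all add: sq_summable_def)
  also have "(\<lambda>i. (1/4) * (u i + v i)\<^sup>2 + (-1/4) * (u i - v i)\<^sup>2) = (\<lambda>i. u i * v i)"
    by (rule ext) (simp add: power2_eq_square field_simps)
  finally show ?thesis .
qed

typedef ell2 = "{u :: int \<Rightarrow> real. sq_summable u}"
  morphisms coord Abs_ell2
  by (rule exI[of _ "\<lambda>_. 0"]) (simp add: sq_summable_def)

setup_lifting type_definition_ell2

lemma ell2_eqI: "(\<And>i. coord u i = coord v i) \<Longrightarrow> u = v"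
  by (simp add: coord_inject[symmetric] fun_eq_iff)

lemma sq_summable_coord [simp]: "sq_summable (coord u)"
  using coord[of u] by simp

instantiation ell2 :: real_vector
begin

lift_definition zero_ell2 :: ell2 is "\<lambda>i. 0"
  by (simp add: sq_summable_def)

lift_definition plus_ell2 :: "ell2 \<Rightarrow> ell2 \<Rightarrow> ell2" is "\<lambda>u v i. u i + v i"
  by (rule sq_summable_add)

lift_definition minus_ell2 :: "ell2 \<Rightarrow> ell2 \<Rightarrow> ell2" is "\<lambda>u v i. u i - v i"
  by (rule sq_summable_diff)

lift_definition uminus_ell2 :: "ell2 \<Rightarrow> ell2" is "\<lambda>u i. - u i"
  by (rule sq_summable_uminus)

lift_definition scaleR_ell2 :: "real \<Rightarrow> ell2 \<Rightarrow> ell2" is "\<lambda>c u i. c * u i"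
  by (rule sq_summable_scale)

instance
  by standard (transfer; simp add: fun_eq_iff algebra_simps)+

end

instantiation ell2 :: times
begin

lift_definition times_ell2 :: "ell2 \<Rightarrow> ell2 \<Rightarrow> ell2" is "\<lambda>u v i. u i * v i"
  by (rule sq_summable_mult)

instance ..

end

instantiation ell2 :: real_inner
begin

lift_definition inner_ell2 :: "ell2 \<Rightarrow> ell2 \<Rightarrow> real" is "\<lambda>u v. \<Sum>\<^sub>\<infinity>i. u i * v i" .

definition norm_ell2 :: "ell2 \<Rightarrow> real" where
  "norm_ell2 u = sqrt (inner u u)"

definition sgn_ell2 :: "ell2 \<Rightarrow> ell2" where
  "sgn_ell2 u = u /\<^sub>R norm u"

definition dist_ell2 :: "ell2 \<Rightarrow> ell2 \<Rightarrow> real" where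
  "dist_ell2 u v = norm (u - v)"

definition uniformity_ell2 :: "(ell2 \<times> ell2) filter" where
  "uniformity_ell2 = (INF e\<in>{0<..}. principal {(u, v). dist u v < e})"

definition open_ell2 :: "ell2 set \<Rightarrow> bool" where
  "open_ell2 U \<longleftrightarrow> (\<forall>u\<in>U. eventually (\<lambda>(u', v). u' = u \<longrightarrow> v \<in> U) uniformity)"

instance
proof
  fix u v w :: ell2 and c :: real
  show "inner u v = inner v u"
    by transfer (simp add: mult.commute)
  show "inner (u + v) w = inner u w + inner v w"
    by transfer (simp add: distrib_right infsum_add sq_summable_inner)
  show "inner (c *\<^sub>R u) v = c * inner u v"
    by transfer (simp add: mult.assoc infsum_cmult_right sq_summable_inner)
  show "0 \<le> inner u u"
    by transfer (simp add: infsum_nonneg)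
  show "inner u u = 0 \<longleftrightarrow> u = 0"
  proof
    assume "inner u u = 0"
    then have "coord u i * coord u i = 0" for i
      by (intro nonneg_infsum_le_0D[where A = UNIV and f = "\<lambda>i. coord u i * coord u i"])
        (auto simp: inner_ell2.rep_eq sq_summable_inner)
    then show "u = 0"
      by (intro ell2_eqI) (simp add: zero_ell2.rep_eq)
  qed (transfer, simp)
qed (simp_all only: sgn_ell2_def dist_ell2_def uniformity_ell2_def open_ell2_def norm_ell2_def)

end

lemma abs_coord_le_norm: "\<bar>coord u i\<bar> \<le> norm u"
proof -
  have "sum (\<lambda>i. coord u i * coord u i) {i} \<le> (\<Sum>\<^sub>\<infinity>i. coord u i * coord u i)"
    by (intro finite_sum_le_infsum) (auto simp: sq_summable_inner)
  then show ?thesis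
    by (auto simp: norm_ell2_def inner_ell2.rep_eq power2_eq_square intro!: real_le_rsqrt)
qed

lemma sum_coord_le_norm:
  assumes "finite F"
  shows "(\<Sum>i\<in>F. (coord u i)\<^sup>2) \<le> (norm u)\<^sup>2"
  unfolding power2_norm_eq_inner inner_ell2.rep_eq unfolding power2_eq_square
  using assms by (intro finite_sum_le_infsum) (simp_all add: sq_summable_inner)

instance ell2 :: complete_space
proof
  fix X :: "nat \<Rightarrow> ell2"
  assume X: "Cauchy X"
  have "Cauchy (\<lambda>n. coord (X n) i)" for i
  proof (rule metric_CauchyI)
    fix e :: real assume "0 < e"
    with X obtain N where N: "\<And>m n. m \<ge> N \<Longrightarrow> n \<ge> N \<Longrightarrow> dist (X m) (X n) < e"
      unfolding Cauchy_def by blast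
    have "dist (coord (X m) i) (coord (X n) i) \<le> dist (X m) (X n)" for m n
      using abs_coord_le_norm[of "X m - X n" i]
      by (simp add: dist_norm minus_ell2.rep_eq)
    with N show "\<exists>M. \<forall>m\<ge>M. \<forall>n\<ge>M. dist (coord (X m) i) (coord (X n) i) < e"
      by (meson le_less_trans)
  qed
  then obtain x where x: "\<And>i. (\<lambda>n. coord (X n) i) \<longlonglongrightarrow> x i"
    unfolding Cauchy_convergent_iff convergent_def by metis
  have partial: "(\<Sum>i\<in>F. (x i - coord (X n) i)\<^sup>2) \<le> e\<^sup>2"
    if F: "finite F" and N: "\<And>m. m \<ge> N \<Longrightarrow> dist (X m) (X n) < e" for F N n and e :: real
  proof (rule tendsto_upperbound)
    show "(\<lambda>m. \<Sum>i\<in>F. (coord (X m) i - coord (X n) i)\<^sup>2)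
        \<longlonglongrightarrow> (\<Sum>i\<in>F. (x i - coord (X n) i)\<^sup>2)"
      by (intro tendsto_intros x)
    have "(\<Sum>i\<in>F. (coord (X m) i - coord (X n) i)\<^sup>2) \<le> e\<^sup>2" if "m \<ge> N" for m
      using sum_coord_le_norm[OF F, of "X m - X n"] N[OF that]
        power_mono[of "dist (X m) (X n)" e 2]
      by (simp add: dist_norm minus_ell2.rep_eq)
    then show "\<forall>\<^sub>F m in sequentially. (\<Sum>i\<in>F. (coord (X m) i - coord (X n) i)\<^sup>2) \<le> e\<^sup>2"
      by (auto simp: eventually_sequentially)
  qed simp
  have diff: "sq_summable (\<lambda>i. x i - coord (X n) i)"
    if N: "\<And>m. m \<ge> N \<Longrightarrow> dist (X m) (X n) < e" for N n and e :: real
    unfolding sq_summable_def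
    by (rule nonneg_bdd_above_summable_on)
      (use partial[OF _ N] in \<open>auto simp: bdd_above_def\<close>)
  obtain N0 where "\<And>m. m \<ge> N0 \<Longrightarrow> dist (X m) (X N0) < 1"
    using X unfolding Cauchy_def by (metis order_refl zero_less_one)
  then have "sq_summable x"
    using sq_summable_add[OF diff sq_summable_coord[of "X N0"]] by fastforce
  then have L: "coord (Abs_ell2 x) = x"
    by (simp add: Abs_ell2_inverse)
  have "X \<longlonglongrightarrow> Abs_ell2 x"
  proof (rule metric_LIMSEQ_I)
    fix e :: real assume e: "0 < e"
    then obtain N where N: "\<And>m n. m \<ge> N \<Longrightarrow> n \<ge> N \<Longrightarrow> dist (X m) (X n) < e / 2"
      using X unfolding Cauchy_def by (meson half_gt_zero)
    have "dist (X n) (Abs_ell2 x) < e" if "n \<ge> N" for n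
    proof -
      have "(norm (Abs_ell2 x - X n))\<^sup>2 \<le> (e / 2)\<^sup>2"
        unfolding power2_norm_eq_inner inner_ell2.rep_eq
      proof (rule infsum_le_finite_sums)
        show "(\<lambda>i. coord (Abs_ell2 x - X n) i * coord (Abs_ell2 x - X n) i) summable_on UNIV"
          by (simp add: sq_summable_inner)
        show "(\<Sum>i\<in>F. coord (Abs_ell2 x - X n) i * coord (Abs_ell2 x - X n) i) \<le> (e / 2)\<^sup>2"
          if "finite F" for F
          using partial[OF that N[OF _ \<open>n \<ge> N\<close>]]
          by (simp add: minus_ell2.rep_eq L power2_eq_square)
      qed
      then have "norm (Abs_ell2 x - X n) \<le> e / 2"
        using e by (simp add: power2_le_iff_abs_le)
      then show ?thesis
        using e by (simp add: dist_norm norm_minus_commute)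
    qed
    then show "\<exists>N. \<forall>n\<ge>N. dist (X n) (Abs_ell2 x) < e" by blast
  qed
  then show "convergent X"
    by (rule convergentI)
qed


section \<open>The discrete Burgers--Huxley vector field\<close>

lift_definition Lap :: "ell2 \<Rightarrow> ell2" is "\<lambda>u i. - u (i - 1) + 2 * u i - u (i + 1)"
proof -
  fix u assume u: "sq_summable u"
  have "sq_summable (\<lambda>i. (2 * u i - u (i + (-1))) - u (i + 1))"
    by (intro sq_summable_diff sq_summable_scale sq_summable_shift u)
  then show "sq_summable (\<lambda>i. - u (i - 1) + 2 * u i - u (i + 1))"
    by simp
qed

lift_definition Dminus :: "ell2 \<Rightarrow> ell2" is "\<lambda>u i. u (i - 1) - u i"
proof -
  fix u assume u: "sq_summable u"
  show "sq_summable (\<lambda>i. u (i - 1) - u i)"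
    using sq_summable_diff[OF sq_summable_shift[OF u, of "-1"] u] by simp
qed

text \<open>The product \<open>u (1 - u) (u - \<gamma>)\<close> is defined componentwise as a whole, because
  the constant sequences \<open>1\<close> and \<open>\<gamma>\<close> are not square-summable.\<close>

lift_definition huxley :: "real \<Rightarrow> ell2 \<Rightarrow> ell2" is
  "\<lambda>\<gamma> u i. u i * (1 - u i) * (u i - \<gamma>)"
proof -
  fix \<gamma> u assume u: "sq_summable u"
  have "sq_summable (\<lambda>i. (u i - u i * u i) * u i - \<gamma> * (u i - u i * u i))"
    by (intro sq_summable_diff sq_summable_mult sq_summable_scale u)
  then show "sq_summable (\<lambda>i. u i * (1 - u i) * (u i - \<gamma>))"
    by (simp add: algebra_simps)
qed

definition BH_field ::
  "real \<Rightarrow> real \<Rightarrow> real \<Rightarrow> real \<Rightarrow> real \<Rightarrow> ell2 \<Rightarrow> ell2 \<Rightarrow> ell2" where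
  "BH_field \<alpha> \<beta> \<gamma> \<nu> lam f u =
     \<nu> *\<^sub>R Lap u - \<alpha> *\<^sub>R (u * Dminus u) + \<beta> *\<^sub>R huxley \<gamma> u - lam *\<^sub>R u + f"

definition lambda_star :: "real \<Rightarrow> real \<Rightarrow> real \<Rightarrow> real \<Rightarrow> real" where
  "lambda_star \<alpha> \<beta> \<gamma> \<nu> = 4 * \<nu> + (2 * \<alpha> + \<beta> + \<beta> * \<gamma>)\<^sup>2 / (4 * \<beta>) - \<beta> * \<gamma>"

definition M_const ::
  "real \<Rightarrow> real \<Rightarrow> real \<Rightarrow> real \<Rightarrow> real \<Rightarrow> ell2 \<Rightarrow> real \<Rightarrow> real" where
  "M_const \<alpha> \<beta> \<gamma> \<nu> lam f r =
     \<beta> * r ^ 3 + (2 * \<alpha> + \<beta> + \<beta> * \<gamma>) * r\<^sup>2 + (4 * \<nu> + \<beta> * \<gamma> + lam) * r + norm f"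

definition L_const :: "real \<Rightarrow> real \<Rightarrow> real \<Rightarrow> real \<Rightarrow> real \<Rightarrow> real \<Rightarrow> real" where
  "L_const \<alpha> \<beta> \<gamma> \<nu> lam r =
     4 * \<nu> + 2 * sqrt 5 * r * \<alpha>
       + sqrt (12 * r\<^sup>2 * (1 + \<gamma>)\<^sup>2 + 27 * r ^ 4 + 3 * \<gamma>\<^sup>2) * \<beta> + lam"

definition r_star ::
  "real \<Rightarrow> real \<Rightarrow> real \<Rightarrow> real \<Rightarrow> real \<Rightarrow> ell2 \<Rightarrow> real" where
  "r_star \<alpha> \<beta> \<gamma> \<nu> lam f = 1 + norm f / (lam - lambda_star \<alpha> \<beta> \<gamma> \<nu>)"

definition eps_star ::
  "real \<Rightarrow> real \<Rightarrow> real \<Rightarrow> real \<Rightarrow> real \<Rightarrow> ell2 \<Rightarrow> real" where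
  "eps_star \<alpha> \<beta> \<gamma> \<nu> lam f =
     (let R = r_star \<alpha> \<beta> \<gamma> \<nu> lam f + 1
      in min (1 / M_const \<alpha> \<beta> \<gamma> \<nu> lam f R) (1 / (1 + L_const \<alpha> \<beta> \<gamma> \<nu> lam R)))"

end

theory Submission
  imports Defs
begin

text \<open>With \<open>R = r\<^sup>* + 1\<close>, the map \<open>v \<mapsto> w + \<epsilon> F v\<close> is a contraction of the ball \<open>B\<^sub>R\<close> for every
  \<open>w\<close> in the ball of radius \<open>r\<^sup>*\<close>, because \<open>\<epsilon> M\<^sub>R \<le> 1\<close> and \<open>\<epsilon> L\<^sub>R < 1\<close>. Its fixed point lies in the
  smaller ball by the dissipativity estimate
  \<open>(F u, u) \<le> - (\<lambda> - \<lambda>\<^sup>*) \<parallel>u\<parallel>\<^sup>2 + \<parallel>f\<parallel> \<parallel>u\<parallel>\<close>.\<close>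

section \<open>Componentwise domination and translations\<close>

lemma norm_ell2_dominated:
  assumes "0 \<le> c" and le: "\<And>i. \<bar>coord u i\<bar> \<le> c * \<bar>coord v i\<bar>"
  shows "norm u \<le> c * norm v"
proof -
  have "inner u u \<le> c\<^sup>2 * inner v v"
    unfolding inner_ell2.rep_eq
  proof (subst infsum_cmult_right[symmetric], simp add: sq_summable_inner, rule infsum_mono)
    show "coord u i * coord u i \<le> c\<^sup>2 * (coord v i * coord v i)" for i
      using power_mono[OF le[of i], of 2] by (simp add: power2_eq_square algebra_simps)
  qed (auto intro!: summable_on_cmult_right sq_summable_inner)
  then show ?thesis
    using \<open>0 \<le> c\<close> unfolding norm_ell2_def
    by (metis real_sqrt_le_mono real_sqrt_mult real_sqrt_abs abs_of_nonneg)
qed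

text \<open>Coordinates are bounded by the norm (\<open>abs_coord_le_norm\<close>), so
  \<open>c\<close> can be taken as a norm bound on \<open>u\<close>. The convection products are
  estimated this way.\<close>

lemma norm_ell2_mult_le:
  assumes "0 \<le> c" and "\<And>i. \<bar>coord u i\<bar> \<le> c"
  shows "norm (u * v) \<le> c * norm v"
  using assms by (intro norm_ell2_dominated) (auto simp: times_ell2.rep_eq abs_mult mult_right_mono)

text \<open>Translation is an isometry. Writing \<open>Lap\<close> and \<open>Dminus\<close> through
  it makes their bounds 4 and 2 a matter of the triangle inequality.\<close>

lift_definition shift :: "int \<Rightarrow> ell2 \<Rightarrow> ell2" is "\<lambda>k u i. u (i + k)"
  by (rule sq_summable_shift)

text \<open>Translation permutes the integers, and reindexing by a bijection needs no summability of
  \<open>g\<close>. This makes the differences of cubes cancel in the energy estimate.\<close>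

lemma infsum_shift: "(\<Sum>\<^sub>\<infinity>i. g (i + k)) = (\<Sum>\<^sub>\<infinity>i::int. g i :: real)"
proof -
  have "bij_betw (\<lambda>i::int. i + k) UNIV UNIV"
    by (rule bij_betwI[where g = "\<lambda>i. i - k"]) auto
  then show ?thesis by (rule infsum_reindex_bij_betw)
qed

lemma summable_on_shift:
  fixes g :: "int \<Rightarrow> real"
  assumes "g summable_on UNIV"
  shows "(\<lambda>i. g (i + k)) summable_on UNIV"
proof -
  have "bij_betw (\<lambda>i::int. i + k) UNIV UNIV"
    by (rule bij_betwI[where g = "\<lambda>i. i - k"]) auto
  from summable_on_reindex_bij_betw[OF this, of g] assms show ?thesis by simp
qed

lemma norm_shift [simp]: "norm (shift k u) = norm u"
  by (simp add: norm_ell2_def inner_ell2.rep_eq shift.rep_eq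
      infsum_shift[where g = "\<lambda>i. coord u i * coord u i"])

lemma Lap_eq_shift: "Lap u = 2 *\<^sub>R u - shift (-1) u - shift 1 u"
  by (rule ell2_eqI) (simp add: Lap.rep_eq minus_ell2.rep_eq scaleR_ell2.rep_eq shift.rep_eq)

lemma Dminus_eq_shift: "Dminus u = shift (-1) u - u"
  by (rule ell2_eqI) (simp add: Dminus.rep_eq minus_ell2.rep_eq shift.rep_eq)

section \<open>Bounds and Lipschitz estimates for the single terms of the field\<close>

lemma norm_Lap_le: "norm (Lap u) \<le> 4 * norm u"
  using norm_triangle_ineq4[of "2 *\<^sub>R u - shift (-1) u" "shift 1 u"]
    norm_triangle_ineq4[of "2 *\<^sub>R u" "shift (-1) u"]
  by (simp add: Lap_eq_shift)

lemma norm_Dminus_le: "norm (Dminus u) \<le> 2 * norm u"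
  using norm_triangle_ineq4[of "shift (-1) u" u] by (simp add: Dminus_eq_shift)

lemma Lap_diff: "Lap (u - v) = Lap u - Lap v"
  by (rule ell2_eqI) (simp add: Lap.rep_eq minus_ell2.rep_eq)

lemma norm_convection_le:
  assumes "norm u \<le> r"
  shows "norm (u * Dminus u) \<le> 2 * r\<^sup>2"
proof -
  have r: "0 \<le> r" using assms norm_ge_zero order_trans by blast
  have "norm (u * Dminus u) \<le> r * norm (Dminus u)"
    using r assms abs_coord_le_norm[of u] by (intro norm_ell2_mult_le) (auto intro: order_trans)
  also have "\<dots> \<le> r * (2 * r)"
    using r assms norm_Dminus_le[of u] by (intro mult_left_mono) auto
  finally show ?thesis by (simp add: power2_eq_square)
qed

text \<open>A discrete product rule splits the difference into \<open>u * Dminus (u - v)\<close> and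
  \<open>Dminus v * (u - v)\<close>. Each part contributes \<open>2 * r\<close>, the 2 being the
  bound on \<open>Dminus\<close>.\<close>

lemma norm_convection_diff_le:
  assumes "norm u \<le> r" "norm v \<le> r"
  shows "norm (u * Dminus u - v * Dminus v) \<le> 4 * r * norm (u - v)"
proof -
  have r: "0 \<le> r" using assms norm_ge_zero order_trans by blast
  have "u * Dminus u - v * Dminus v = u * Dminus (u - v) + Dminus v * (u - v)"
    by (rule ell2_eqI)
      (simp add: plus_ell2.rep_eq minus_ell2.rep_eq times_ell2.rep_eq Dminus.rep_eq algebra_simps)
  moreover have "norm (u * Dminus (u - v)) \<le> r * norm (Dminus (u - v))"
    using r assms abs_coord_le_norm[of u] by (intro norm_ell2_mult_le) (auto intro: order_trans)
  moreover have "r * norm (Dminus (u - v)) \<le> r * (2 * norm (u - v))"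
    using r norm_Dminus_le by (intro mult_left_mono)
  moreover have "norm (Dminus v * (u - v)) \<le> (2 * r) * norm (u - v)"
  proof (rule norm_ell2_mult_le)
    show "\<bar>coord (Dminus v) i\<bar> \<le> 2 * r" for i
      using abs_coord_le_norm[of "Dminus v" i] norm_Dminus_le[of v] assms by linarith
  qed (use r in simp)
  ultimately show ?thesis
    using norm_triangle_ineq[of "u * Dminus (u - v)" "Dminus v * (u - v)"] by simp
qed

text \<open>Besides \<open>u\<close> itself, the two factors are at most \<open>1 + r\<close> and
  \<open>r + \<gamma>\<close> in each coordinate; \<open>(1 + r) * (r + \<gamma>) * r\<close>
  expands to exactly the stated bound.\<close>

lemma norm_huxley_le:
  assumes "0 \<le> \<gamma>" and u: "norm u \<le> r"
  shows "norm (huxley \<gamma> u) \<le> r ^ 3 + (1 + \<gamma>) * r\<^sup>2 + \<gamma> * r"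
proof -
  have r: "0 \<le> r" using u norm_ge_zero order_trans by blast
  have "norm (huxley \<gamma> u) \<le> ((1 + r) * (r + \<gamma>)) * norm u"
  proof (rule norm_ell2_dominated)
    fix i
    have x: "\<bar>coord u i\<bar> \<le> r"
      using abs_coord_le_norm[of u i] u by linarith
    have "\<bar>1 - coord u i\<bar> * \<bar>coord u i - \<gamma>\<bar> \<le> (1 + r) * (r + \<gamma>)"
      using x r assms by (intro mult_mono) auto
    from mult_right_mono[OF this, of "\<bar>coord u i\<bar>"]
    show "\<bar>coord (huxley \<gamma> u) i\<bar> \<le> (1 + r) * (r + \<gamma>) * \<bar>coord u i\<bar>"
      by (simp add: huxley.rep_eq abs_mult ac_simps)
  qed (use r assms in simp)
  also have "\<dots> \<le> ((1 + r) * (r + \<gamma>)) * r"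
    using r assms by (intro mult_left_mono) auto
  finally show ?thesis
    by (simp add: power2_eq_square power3_eq_cube algebra_simps)
qed

text \<open>In each coordinate \<open>x - y\<close> factors out of the difference of the cubics and
  leaves a symmetric quadratic polynomial in \<open>x\<close> and \<open>y\<close>, which is bounded
  term by term.\<close>

lemma norm_huxley_diff_le:
  assumes "0 \<le> \<gamma>" and u: "norm u \<le> r" and v: "norm v \<le> r"
  shows "norm (huxley \<gamma> u - huxley \<gamma> v) \<le> (3 * r\<^sup>2 + 2 * (1 + \<gamma>) * r + \<gamma>) * norm (u - v)"
proof (rule norm_ell2_dominated)
  have r: "0 \<le> r" using u norm_ge_zero order_trans by blast
  then show "0 \<le> 3 * r\<^sup>2 + 2 * (1 + \<gamma>) * r + \<gamma>" using assms by simp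
  fix i
  define x y where "x = coord u i" and "y = coord v i"
  have x: "\<bar>x\<bar> \<le> r" and y: "\<bar>y\<bar> \<le> r"
    using abs_coord_le_norm[of u i] abs_coord_le_norm[of v i] u v by (auto simp: x_def y_def)
  have "\<bar>x * x\<bar> \<le> r * r" "\<bar>x * y\<bar> \<le> r * r" "\<bar>y * y\<bar> \<le> r * r"
    unfolding abs_mult using x y r by (intro mult_mono; simp)+
  then have "\<bar>x * x + x * y + y * y\<bar> \<le> 3 * r\<^sup>2"
    unfolding power2_eq_square by linarith
  moreover have "\<bar>(1 + \<gamma>) * (x + y)\<bar> \<le> (1 + \<gamma>) * (2 * r)"
    unfolding abs_mult using x y assms by (intro mult_mono) auto
  ultimately have "\<bar>- (x * x + x * y + y * y) + (1 + \<gamma>) * (x + y) - \<gamma>\<bar>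
      \<le> 3 * r\<^sup>2 + 2 * (1 + \<gamma>) * r + \<gamma>"
    using assms(1) by (simp add: abs_le_iff algebra_simps)
  moreover have "x * (1 - x) * (x - \<gamma>) - y * (1 - y) * (y - \<gamma>)
      = (- (x * x + x * y + y * y) + (1 + \<gamma>) * (x + y) - \<gamma>) * (x - y)"
    by algebra
  ultimately show "\<bar>coord (huxley \<gamma> u - huxley \<gamma> v) i\<bar>
      \<le> (3 * r\<^sup>2 + 2 * (1 + \<gamma>) * r + \<gamma>) * \<bar>coord (u - v) i\<bar>"
    by (simp add: huxley.rep_eq minus_ell2.rep_eq abs_mult mult_right_mono flip: x_def y_def)
qed

section \<open>Size and Lipschitz constant of the whole field\<close>

lemma norm_BH_field_le:
  assumes "0 \<le> \<alpha>" "0 \<le> \<beta>" "0 \<le> \<nu>" "0 \<le> lam" "0 \<le> \<gamma>" and u: "norm u \<le> r"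
  shows "norm (BH_field \<alpha> \<beta> \<gamma> \<nu> lam f u) \<le> M_const \<alpha> \<beta> \<gamma> \<nu> lam f r"
proof -
  have "norm (BH_field \<alpha> \<beta> \<gamma> \<nu> lam f u) \<le>
      norm (\<nu> *\<^sub>R Lap u) + norm (\<alpha> *\<^sub>R (u * Dminus u)) + norm (\<beta> *\<^sub>R huxley \<gamma> u)
        + norm (lam *\<^sub>R u) + norm f"
    unfolding BH_field_def
    by (intro norm_triangle_le norm_triangle_le_diff add_mono order_refl)
  also have "\<dots> \<le> \<nu> * (4 * r) + \<alpha> * (2 * r\<^sup>2) + \<beta> * (r ^ 3 + (1 + \<gamma>) * r\<^sup>2 + \<gamma> * r)
        + lam * r + norm f"
    using assms norm_Lap_le[of u] norm_convection_le[OF u] norm_huxley_le[OF assms(5) u]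
    by (intro add_mono) (auto intro!: mult_left_mono)
  also have "\<dots> = M_const \<alpha> \<beta> \<gamma> \<nu> lam f r"
    by (simp add: M_const_def algebra_simps)
  finally show ?thesis .
qed

text \<open>The termwise estimates add up to the constant
  \<open>4 * \<nu> + 4 * r * \<alpha> + ?h * \<beta> + lam\<close>, which is then dominated by
  \<open>L_const\<close>.\<close>

lemma norm_BH_field_diff_le:
  assumes "0 \<le> \<alpha>" "0 \<le> \<beta>" "0 \<le> \<nu>" "0 \<le> lam" "0 \<le> \<gamma>"
    and u: "norm u \<le> r" and v: "norm v \<le> r"
  shows "norm (BH_field \<alpha> \<beta> \<gamma> \<nu> lam f u - BH_field \<alpha> \<beta> \<gamma> \<nu> lam f v)
    \<le> L_const \<alpha> \<beta> \<gamma> \<nu> lam r * norm (u - v)"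
proof -
  have r: "0 \<le> r" using u norm_ge_zero order_trans by blast
  let ?d = "norm (u - v)"
  let ?h = "3 * r\<^sup>2 + 2 * (1 + \<gamma>) * r + \<gamma>"
  have "BH_field \<alpha> \<beta> \<gamma> \<nu> lam f u - BH_field \<alpha> \<beta> \<gamma> \<nu> lam f v =
      \<nu> *\<^sub>R Lap (u - v) - \<alpha> *\<^sub>R (u * Dminus u - v * Dminus v)
        + \<beta> *\<^sub>R (huxley \<gamma> u - huxley \<gamma> v) - lam *\<^sub>R (u - v)"
    unfolding BH_field_def Lap_diff by (simp add: algebra_simps)
  also have "norm \<dots> \<le> norm (\<nu> *\<^sub>R Lap (u - v)) + norm (\<alpha> *\<^sub>R (u * Dminus u - v * Dminus v))
        + norm (\<beta> *\<^sub>R (huxley \<gamma> u - huxley \<gamma> v)) + norm (lam *\<^sub>R (u - v))"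
    by (intro norm_triangle_le norm_triangle_le_diff add_mono order_refl)
  also have "\<dots> \<le> \<nu> * (4 * ?d) + \<alpha> * (4 * r * ?d) + \<beta> * (?h * ?d) + lam * ?d"
    using assms norm_Lap_le[of "u - v"] norm_convection_diff_le[OF u v]
      norm_huxley_diff_le[OF assms(5) u v]
    by (intro add_mono) (auto intro!: mult_left_mono)
  also have "\<dots> = (4 * \<nu> + 4 * r * \<alpha> + ?h * \<beta> + lam) * ?d"
    by (simp add: algebra_simps)
  also have "\<dots> \<le> L_const \<alpha> \<beta> \<gamma> \<nu> lam r * ?d"
  proof (rule mult_right_mono)
    have "(2::real) \<le> sqrt 5" by (rule real_le_rsqrt) simp
    then have "4 * r * \<alpha> \<le> 2 * sqrt 5 * r * \<alpha>"
      using r assms by (intro mult_right_mono) auto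
    moreover have "?h \<le> sqrt (12 * r\<^sup>2 * (1 + \<gamma>)\<^sup>2 + 27 * r ^ 4 + 3 * \<gamma>\<^sup>2)"
    proof (rule real_le_rsqrt)
      \<comment> \<open>Cauchy-Schwarz for three terms: applied to the summands of
        \<open>?h\<close>, it produces exactly the coefficients 27, 12 and 3 of the
        radicand.\<close>
      have *: "(a + b + c)\<^sup>2 \<le> 3 * (a\<^sup>2 + b\<^sup>2 + c\<^sup>2)" for a b c :: real
        using zero_le_power2[of "a - b"] zero_le_power2[of "a - c"] zero_le_power2[of "b - c"]
        by (simp add: power2_eq_square algebra_simps)
      show "?h\<^sup>2 \<le> 12 * r\<^sup>2 * (1 + \<gamma>)\<^sup>2 + 27 * r ^ 4 + 3 * \<gamma>\<^sup>2"
        using *[of "3 * r\<^sup>2" "2 * (1 + \<gamma>) * r" \<gamma>]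
        unfolding power_mult_distrib by (simp add: algebra_simps)
    qed
    ultimately show "4 * \<nu> + 4 * r * \<alpha> + ?h * \<beta> + lam \<le> L_const \<alpha> \<beta> \<gamma> \<nu> lam r"
      unfolding L_const_def using mult_right_mono[OF _ \<open>0 \<le> \<beta>\<close>]
      by (intro add_right_mono add_mono order_refl) auto
  qed simp
  finally show ?thesis .
qed

section \<open>Dissipativity of the field\<close>

text \<open>Young's inequality bounds \<open>x\<^sup>2 \<bar>y\<bar>\<close> by \<open>(2 \<bar>x\<bar>\<^sup>3 + \<bar>y\<bar>\<^sup>3) / 3\<close>, which leaves a difference of cubes
  that telescopes to zero when summed over the lattice; completing the square then absorbs the
  remaining \<open>\<bar>x\<bar>\<^sup>3\<close> into \<open>\<beta> x\<^sup>4\<close>.\<close>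
lemma nonlinearity_pointwise_le:
  fixes x y :: real
  assumes "0 \<le> \<alpha>" "0 < \<beta>" "0 \<le> \<gamma>"
  shows "(- \<alpha> * (x * (y - x)) + \<beta> * (x * (1 - x) * (x - \<gamma>))) * x
    \<le> ((2 * \<alpha> + \<beta> + \<beta> * \<gamma>)\<^sup>2 / (4 * \<beta>) - \<beta> * \<gamma>) * (x * x) + \<alpha> / 3 * (\<bar>y\<bar> ^ 3 - \<bar>x\<bar> ^ 3)"
proof -
  define a b K where "a = \<bar>x\<bar>" and "b = \<bar>y\<bar>" and "K = 2 * \<alpha> + \<beta> + \<beta> * \<gamma>"
  have a: "a \<ge> 0" and b: "b \<ge> 0" by (auto simp: a_def b_def)
  have xx: "x * x = a * a" by (simp add: a_def)
  \<comment> \<open>The product expands to \<open>2 * a ^ 3 - 3 * a * a * b + b ^ 3\<close>.\<close>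
  have "0 \<le> (a - b)\<^sup>2 * (2 * a + b)" using a b by simp
  then have "a * a * b \<le> (2 * a ^ 3 + b ^ 3) / 3"
    by (simp add: power2_eq_square power3_eq_cube algebra_simps)
  moreover have "- (x * x * y) \<le> a * a * b"
    using mult_left_mono[of "- y" b "x * x"] unfolding xx[symmetric] by (simp add: b_def)
  moreover have x3: "x * x * x \<le> a ^ 3"
    using mult_left_mono[of x a "x * x"] unfolding power3_eq_cube xx[symmetric] by (simp add: a_def)
  ultimately have "\<alpha> * (- (x * x * y) + x * x * x) \<le> \<alpha> * ((5 * a ^ 3 + b ^ 3) / 3)"
    using assms by (intro mult_left_mono) auto
  moreover have "\<beta> * (1 + \<gamma>) * (x * x * x) \<le> \<beta> * (1 + \<gamma>) * a ^ 3"
    using x3 assms by (intro mult_left_mono) auto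
  moreover have "K * a ^ 3 - \<beta> * (a * a) * (a * a) \<le> K\<^sup>2 / (4 * \<beta>) * (a * a)"
  proof -
    \<comment> \<open>\<open>k\<close> maximises \<open>K * a - \<beta> * a * a\<close> over
      \<open>a\<close>; the maximum is K squared over \<open>4 * \<beta>\<close>, the quotient in
      \<open>lambda_star\<close>.\<close>
    define k where "k = K / (2 * \<beta>)"
    have K: "K = 2 * \<beta> * k" using assms by (simp add: k_def)
    have "0 \<le> (k - a)\<^sup>2 * \<beta> * (a * a)" using assms by simp
    also have "\<dots> = \<beta> * k\<^sup>2 * (a * a) - (K * a ^ 3 - \<beta> * (a * a) * (a * a))"
      unfolding K by algebra
    also have "\<beta> * k\<^sup>2 = K\<^sup>2 / (4 * \<beta>)"
      using assms by (simp add: k_def power2_eq_square)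
    finally show ?thesis by simp
  qed
  moreover have "(- \<alpha> * (x * (y - x)) + \<beta> * (x * (1 - x) * (x - \<gamma>))) * x
      = \<alpha> * (- (x * x * y) + x * x * x) + \<beta> * (1 + \<gamma>) * (x * x * x)
        - \<beta> * (x * x) * (x * x) - \<beta> * \<gamma> * (x * x)"
    by algebra
  \<comment> \<open>Splitting 5/3 as 2 - 1/3 puts \<open>2 * \<alpha>\<close> into \<open>K\<close>
    and leaves the telescoping difference of cubes.\<close>
  moreover have "\<alpha> * ((5 * a ^ 3 + b ^ 3) / 3) + \<beta> * (1 + \<gamma>) * a ^ 3
      = K * a ^ 3 + \<alpha> / 3 * (b ^ 3 - a ^ 3)"
    by (simp add: K_def field_simps)
  ultimately show ?thesis
    unfolding K_def[symmetric] a_def[symmetric] b_def[symmetric] left_diff_distrib xx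
    by linarith
qed

text \<open>The cube is the product of the square-summable sequences of squares and of absolute
  values. Finite cube sums are what allows cancelling them below.\<close>

lemma summable_on_abs_cube: "(\<lambda>i. \<bar>coord u i\<bar> ^ 3) summable_on UNIV"
proof -
  have "sq_summable (\<lambda>i. \<bar>coord u i\<bar>)"
    by (rule sq_summable_dominated[of "coord u" _ 1]) auto
  then show ?thesis
    using sq_summable_inner[OF sq_summable_mult, of "\<lambda>i. \<bar>coord u i\<bar>" "\<lambda>i. \<bar>coord u i\<bar>" "\<lambda>i. \<bar>coord u i\<bar>"]
    by (simp add: power3_eq_cube)
qed

text \<open>Sum the pointwise estimate with \<open>x\<close> the coordinate at \<open>i\<close> and
  \<open>y\<close> the one at \<open>i - 1\<close>. Translation invariance gives both cubes the same
  sum.\<close>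

lemma inner_nonlinearity_le:
  assumes "0 \<le> \<alpha>" "0 < \<beta>" "0 \<le> \<gamma>"
  shows "inner (- \<alpha> *\<^sub>R (u * Dminus u) + \<beta> *\<^sub>R huxley \<gamma> u) u
    \<le> ((2 * \<alpha> + \<beta> + \<beta> * \<gamma>)\<^sup>2 / (4 * \<beta>) - \<beta> * \<gamma>) * (norm u)\<^sup>2"
proof -
  let ?c = "(2 * \<alpha> + \<beta> + \<beta> * \<gamma>)\<^sup>2 / (4 * \<beta>) - \<beta> * \<gamma>"
  let ?g = "\<lambda>i. \<bar>coord u i\<bar> ^ 3"
  let ?w = "- \<alpha> *\<^sub>R (u * Dminus u) + \<beta> *\<^sub>R huxley \<gamma> u"
  let ?T = "\<Sum>\<^sub>\<infinity>i. ?g i"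
  have w: "(\<lambda>i. coord ?w i * coord u i) summable_on UNIV"
    by (intro sq_summable_inner) auto
  have sq: "(\<lambda>i. ?c * (coord u i * coord u i)) summable_on UNIV"
    by (intro summable_on_cmult_right sq_summable_inner) auto
  have g: "(\<lambda>i. \<alpha> / 3 * ?g i) summable_on UNIV"
    by (intro summable_on_cmult_right summable_on_abs_cube)
  note g' = summable_on_shift[OF g, of "-1"]
  \<comment> \<open>The cubes are kept with a positive sign, one family on each side, so that the
    same finite term \<open>\<alpha> / 3 * ?T\<close> cancels at the end.\<close>
  have "inner ?w u + \<alpha> / 3 * ?T = (\<Sum>\<^sub>\<infinity>i. coord ?w i * coord u i + \<alpha> / 3 * ?g i)"
    by (subst infsum_add[OF w g]) (simp only: infsum_cmult_right' inner_ell2.rep_eq)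
  also have "\<dots> \<le> (\<Sum>\<^sub>\<infinity>i. ?c * (coord u i * coord u i) + \<alpha> / 3 * ?g (i + (-1)))"
  proof (rule infsum_mono[OF summable_on_add[OF w g] summable_on_add[OF sq g']])
    show "coord ?w i * coord u i + \<alpha> / 3 * ?g i
        \<le> ?c * (coord u i * coord u i) + \<alpha> / 3 * ?g (i + (-1))" for i
      using nonlinearity_pointwise_le[OF assms, of "coord u i" "coord u (i - 1)"]
      unfolding plus_ell2.rep_eq scaleR_ell2.rep_eq times_ell2.rep_eq Dminus.rep_eq huxley.rep_eq
      by (simp only: right_diff_distrib[of "\<alpha> / 3"] diff_conv_add_uminus[of i 1, symmetric])
  qed
  also have "\<dots> = ?c * inner u u + \<alpha> / 3 * ?T"
    by (subst infsum_add[OF sq g'])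
      (simp only: infsum_cmult_right' inner_ell2.rep_eq infsum_shift[where g = ?g])
  finally show ?thesis by (simp add: power2_norm_eq_inner)
qed

text \<open>The three parts of \<open>lambda_star\<close> have separate sources:
  \<open>4 * \<nu>\<close> comes from Cauchy-Schwarz for \<open>Lap\<close>, the quotient and
  \<open>- \<beta> * \<gamma>\<close> from the nonlinearity.\<close>

lemma inner_BH_field_le:
  assumes "0 \<le> \<alpha>" "0 < \<beta>" "0 \<le> \<nu>" "0 \<le> \<gamma>"
  shows "inner (BH_field \<alpha> \<beta> \<gamma> \<nu> lam f u) u
    \<le> - (lam - lambda_star \<alpha> \<beta> \<gamma> \<nu>) * (norm u)\<^sup>2 + norm f * norm u"
proof -
  have "inner (Lap u) u \<le> 4 * norm u * norm u"
    using norm_cauchy_schwarz[of "Lap u" u] mult_right_mono[OF norm_Lap_le[of u], of "norm u"]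
    by simp
  then have "\<nu> * inner (Lap u) u \<le> \<nu> * (4 * (norm u)\<^sup>2)"
    using assms by (intro mult_left_mono) (simp_all add: power2_eq_square)
  moreover have "inner f u \<le> norm f * norm u"
    by (rule norm_cauchy_schwarz)
  moreover have "inner (BH_field \<alpha> \<beta> \<gamma> \<nu> lam f u) u = \<nu> * inner (Lap u) u
      + inner (- \<alpha> *\<^sub>R (u * Dminus u) + \<beta> *\<^sub>R huxley \<gamma> u) u - lam * (norm u)\<^sup>2 + inner f u"
    by (simp add: BH_field_def inner_add_left inner_diff_left power2_norm_eq_inner)
  ultimately show ?thesis
    using inner_nonlinearity_le[OF assms(1,2,4), of u]
    by (simp add: lambda_star_def algebra_simps)
qed

section \<open>A single implicit Euler step\<close>

text \<open>Take the inner product of the equation with \<open>u\<close> and divide by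
  \<open>norm u\<close>. If \<open>norm u\<close> exceeded \<open>r\<close>, the term multiplied by
  \<open>\<epsilon>\<close> would be nonpositive, forcing \<open>norm u \<le> norm w\<close>. No
  prior bound on \<open>u\<close> enters.\<close>

lemma implicit_Euler_step_bound:
  fixes u w :: "'a :: real_inner"
  assumes "0 < \<epsilon>" "0 < \<delta>"
    and diss: "inner (F u) u \<le> - \<delta> * (norm u)\<^sup>2 + c * norm u"
    and u: "u = w + \<epsilon> *\<^sub>R F u"
    and w: "norm w \<le> r" and c: "c \<le> \<delta> * r"
  shows "norm u \<le> r"
proof (rule ccontr)
  assume "\<not> norm u \<le> r"
  then have gt: "r < norm u" by simp
  have pos: "0 < norm u" using gt w norm_ge_zero[of w] by linarith
  have "(norm u)\<^sup>2 = inner w u + \<epsilon> * inner (F u) u"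
    by (metis u inner_add_left inner_scaleR_left power2_norm_eq_inner)
  also have "\<dots> \<le> norm w * norm u + \<epsilon> * (- \<delta> * (norm u)\<^sup>2 + c * norm u)"
    using assms by (intro add_mono norm_cauchy_schwarz mult_left_mono) auto
  finally have "norm u * norm u \<le> (norm w + \<epsilon> * (c - \<delta> * norm u)) * norm u"
    by (simp add: power2_eq_square algebra_simps)
  then have "norm u \<le> norm w + \<epsilon> * (c - \<delta> * norm u)"
    using pos by simp
  moreover have "\<epsilon> * (c - \<delta> * norm u) \<le> 0"
  proof -
    have "\<delta> * r \<le> \<delta> * norm u" using gt assms by (intro mult_left_mono) auto
    then show ?thesis using c \<open>0 < \<epsilon>\<close> by (intro mult_nonneg_nonpos) linarith+
  qed
  ultimately show False using gt w by linarith
qed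

lemma ex1_implicit_Euler_step:
  fixes \<alpha> \<beta> \<gamma> \<nu> lam \<epsilon> :: real and f w :: ell2
  defines "r \<equiv> r_star \<alpha> \<beta> \<gamma> \<nu> lam f"
  assumes par: "0 < \<alpha>" "0 < \<beta>" "0 < \<nu>" "0 < lam" "0 < \<gamma>"
    and lam: "lam > lambda_star \<alpha> \<beta> \<gamma> \<nu>"
    and eps: "0 < \<epsilon>" "\<epsilon> \<le> eps_star \<alpha> \<beta> \<gamma> \<nu> lam f"
    and w: "norm w \<le> r"
  shows "\<exists>!u. u = w + \<epsilon> *\<^sub>R BH_field \<alpha> \<beta> \<gamma> \<nu> lam f u \<and> u \<in> cball 0 r"
proof -
  let ?F = "BH_field \<alpha> \<beta> \<gamma> \<nu> lam f"
  let ?\<delta> = "lam - lambda_star \<alpha> \<beta> \<gamma> \<nu>"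
  define M L where "M = M_const \<alpha> \<beta> \<gamma> \<nu> lam f (r + 1)" and "L = L_const \<alpha> \<beta> \<gamma> \<nu> lam (r + 1)"
  have \<delta>: "0 < ?\<delta>" using lam by simp
  have r: "0 \<le> r" using w norm_ge_zero order_trans by blast
  \<comment> \<open>By the choice of \<open>r_star\<close>, the right-hand side equals
    \<open>?\<delta> + norm f\<close>.\<close>
  have f: "norm f \<le> ?\<delta> * r"
    using \<delta> unfolding r_def r_star_def distrib_left by simp
  have M: "0 < M" unfolding M_def M_const_def
    using par r by (intro add_pos_nonneg add_nonneg_pos mult_pos_pos) auto
  have L: "0 \<le> L" unfolding L_def L_const_def
    using par r by (intro add_nonneg_nonneg mult_nonneg_nonneg) auto
  \<comment> \<open>The two halves of \<open>eps_star\<close> serve the self-map and the contraction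
    property; the 1 added to \<open>L\<close> makes the contraction factor strictly less than
    1.\<close>
  have "\<epsilon> \<le> 1 / M" "\<epsilon> \<le> 1 / (1 + L)"
    using eps(2) by (auto simp: eps_star_def Let_def M_def L_def r_def)
  then have eM: "\<epsilon> * M \<le> 1" and eL: "\<epsilon> * L < 1"
    using M L eps(1) by (simp_all add: field_simps)
  have ex1: "\<exists>!u\<in>cball 0 (r + 1). w + \<epsilon> *\<^sub>R ?F u = u"
  proof (rule Banach_fix)
    show "complete (cball (0::ell2) (r + 1))" by (simp add: complete_eq_closed)
    show "cball (0::ell2) (r + 1) \<noteq> {}" using r by simp
    show "0 \<le> \<epsilon> * L" using L eps by simp
    show "(\<lambda>u. w + \<epsilon> *\<^sub>R ?F u) ` cball 0 (r + 1) \<subseteq> cball 0 (r + 1)"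
    proof (rule image_subsetI)
      fix u :: ell2 assume "u \<in> cball 0 (r + 1)"
      then have "norm (?F u) \<le> M"
        unfolding M_def using par by (intro norm_BH_field_le) auto
      then have "norm (\<epsilon> *\<^sub>R ?F u) \<le> \<epsilon> * M"
        using eps by simp
      \<comment> \<open>The extra unit of radius absorbs the increment, whose norm is at most
        \<open>\<epsilon> * M \<le> 1\<close>.\<close>
      then show "w + \<epsilon> *\<^sub>R ?F u \<in> cball 0 (r + 1)"
        using w eM norm_triangle_ineq[of w "\<epsilon> *\<^sub>R ?F u"] by (simp del: norm_scaleR)
    qed
    show "dist (w + \<epsilon> *\<^sub>R ?F u) (w + \<epsilon> *\<^sub>R ?F v) \<le> \<epsilon> * L * dist u v"
      if "u \<in> cball 0 (r + 1)" "v \<in> cball 0 (r + 1)" for u v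
    proof -
      have "norm (?F u - ?F v) \<le> L * norm (u - v)"
        unfolding L_def using that par by (intro norm_BH_field_diff_le) auto
      then show ?thesis
        using eps by (simp add: dist_norm mult.assoc flip: scaleR_diff_right)
    qed
  qed (rule eL)
  \<comment> \<open>Every solution lies in the smaller ball, so existence and uniqueness pass from
    the ball of radius \<open>r + 1\<close> to that of radius \<open>r\<close>.\<close>
  have "norm u \<le> r" if u: "u = w + \<epsilon> *\<^sub>R ?F u" for u
    by (rule implicit_Euler_step_bound[where F = ?F, OF eps(1) \<delta> inner_BH_field_le u w f])
      (use par in auto)
  then have "(u = w + \<epsilon> *\<^sub>R ?F u \<and> u \<in> cball 0 r) \<longleftrightarrow>
      (u \<in> cball 0 (r + 1) \<and> w + \<epsilon> *\<^sub>R ?F u = u)" for u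
    by (metis dist_0_norm mem_cball less_add_one less_imp_le order_trans)
  with ex1 show ?thesis by simp
qed

section \<open>From one step to the whole sequence\<close>

text \<open>Unique solvability in \<open>S\<close> turns the implicit relation \<open>P\<close> into
  a map \<open>g\<close> of \<open>S\<close> into itself. Its iterates from \<open>x\<close> form
  the sequence, and by induction any other solution agrees with them.\<close>

lemma ex1_implicit_sequence:
  assumes step: "\<And>w. w \<in> S \<Longrightarrow> \<exists>!u. P w u \<and> u \<in> S" and "x \<in> S"
  shows "\<exists>!u :: nat \<Rightarrow> 'a. u 0 = x \<and> (\<forall>n\<ge>1. P (u (n - 1)) (u n)) \<and> (\<forall>n. u n \<in> S)"
proof -
  define g where "g w = (THE u. P w u \<and> u \<in> S)" for w
  have g: "P w (g w) \<and> g w \<in> S" if "w \<in> S" for w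
    unfolding g_def using step[OF that] by (rule theI')
  define u where "u n = (g ^^ n) x" for n
  have uS: "u n \<in> S" for n
    using \<open>x \<in> S\<close> g by (induction n) (auto simp: u_def)
  show ?thesis
  proof (rule ex1I[of _ u])
    have "P (u n) (u (Suc n))" for n
      using g[OF uS[of n]] by (simp add: u_def)
    then have "P (u (n - 1)) (u n)" if "n \<ge> 1" for n
      using that by (cases n) auto
    then show "u 0 = x \<and> (\<forall>n\<ge>1. P (u (n - 1)) (u n)) \<and> (\<forall>n. u n \<in> S)"
      using uS by (simp add: u_def)
  next
    fix v :: "nat \<Rightarrow> 'a"
    assume v: "v 0 = x \<and> (\<forall>n\<ge>1. P (v (n - 1)) (v n)) \<and> (\<forall>n. v n \<in> S)"
    have "v n = u n" for n
    proof (induction n)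
      case (Suc n)
      have "P (v n) (v (Suc n))" using v by (metis diff_Suc_1 le_add1 plus_1_eq_Suc)
      then have "v (Suc n) = g (v n)"
        using v step[of "v n"] g[of "v n"] by blast
      then show ?case using Suc by (simp add: u_def)
    qed (use v in \<open>simp add: u_def\<close>)
    then show "v = u" by blast
  qed
qed

theorem theorem2p1:
  fixes \<alpha> \<beta> \<gamma> \<nu> lam \<epsilon> :: real and f u0 :: ell2
  assumes "\<alpha> > 0" "\<beta> > 0" "\<nu> > 0" "lam > 0" "0 < \<gamma>" "\<gamma> < 1"
    and "lam > lambda_star \<alpha> \<beta> \<gamma> \<nu>"
    and "0 < \<epsilon>" "\<epsilon> \<le> eps_star \<alpha> \<beta> \<gamma> \<nu> lam f"
    and "u0 \<in> cball 0 (r_star \<alpha> \<beta> \<gamma> \<nu> lam f)"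
  shows "\<exists>!u :: nat \<Rightarrow> ell2. u 0 = u0 \<and>
    (\<forall>n\<ge>1. u n = u (n - 1) + \<epsilon> *\<^sub>R BH_field \<alpha> \<beta> \<gamma> \<nu> lam f (u n)) \<and>
    (\<forall>n. u n \<in> cball 0 (r_star \<alpha> \<beta> \<gamma> \<nu> lam f))"
  using assms ex1_implicit_Euler_step
  by (intro ex1_implicit_sequence[where P = "\<lambda>w u. u = w + \<epsilon> *\<^sub>R BH_field \<alpha> \<beta> \<gamma> \<nu> lam f u"]) auto

end
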